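(* Let $X$ be a $P$-space. If $X$ is locally Lindelöf and $c$-well-filtered, then the mapping $$\phi' : \mathcal{O}(X)\to \mathrm{OCFilt}_{\sigma}((\mathcal{LQ}(X),\supseteq)),\qquad \phi'(U)=\{K\in\mathcal{LQ}(X) : K\subseteq U\}$$ is an order isomorphism, where $\mathcal{O}(X)$ and $\mathrm{OCFilt}_{\sigma}((\mathcal{LQ}(X),\supseteq))$ are both ordered by inclusion.
   Context: Let $X$ be a topological space, and let $\mathcal{O}(X)$ be its lattice of open sets. A subset of $X$ is saturated if it is an intersection of open sets (equivalently, an upper set for the specialization order $x\le y \iff x\in \mathrm{cl}(\{y\})$). A subset $A$ is a Lindelöf set if every open cover of $A$ has a countable subcover. $\mathcal{LQ}(X)$ denotes the set of all saturated Lindelöf subsets of $X$ (including $\emptyset$). A nonempty subset $D$ of a poset is countably directed if every countable subset of $D$ has an upper bound belonging to $D$; countably filtered is the dual notion (every countable subset has a lower bound belonging to the set). A family of sets is called countably filtered if it is so with respect to inclusion $\subseteq$. A countable filter of a poset is a nonempty, countably filtered, upper set. An upper set $U$ of a poset $L$ is $\sigma$-Scott open if for every countably directed $D\subseteq L$ having a least upper bound $\sup D$, $\sup D\in U$ implies $D\cap U\ne\emptyset$. $(\mathcal{LQ}(X),\supseteq)$ is the poset $\mathcal{LQ}(X)$ with the reverse inclusion order: $K\le Q$ iff $K\supseteq Q$. $\mathrm{OCFilt}_{\sigma}((\mathcal{LQ}(X),\supseteq))$ is the set of all $\sigma$-Scott open countable filters of this poset. $X$ is $c$-well-filtered if for every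 countably filtered family $\{K_i\}_{i\in I}$ of saturated Lindelöf subsets of $X$ and each open $U$ with $\bigcap_{i\in I}K_i\subseteq U$, there is $i_0\in I$ with $K_{i_0}\subseteq U$. $X$ is locally Lindelöf if for every open $U$ and every $x\in U$ there is $K\in\mathcal{LQ}(X)$ with $x\in\mathrm{int}(K)\subseteq K\subseteq U$. $X$ is a $P$-space if for every point $p\in X$ the system of neighbourhoods of $p$ is closed under countable intersections. *)

theory Defs
  imports "HOL-Analysis.Analysis" "HOL-Algebra.Order"
begin

section \<open>Order-theoretic notions\<close>

text \<open>
  Posets are HOL-Algebra orders whose equality is \<open>(=)\<close>. A family of sets ordered by inclusion
  is \<open>inclusion_order \<A>\<close>; the reverse inclusion order is its \<^const>\<open>inv_gorder\<close>.
\<close>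

definition inclusion_order :: "'a set set \<Rightarrow> 'a set gorder"
  where "inclusion_order \<A> = \<lparr>carrier = \<A>, eq = (=), le = (\<subseteq>)\<rparr>"

lemma partial_order_inclusion_order: "partial_order (inclusion_order \<A>)"
  unfolding inclusion_order_def by unfold_locales auto

definition countably_directed :: "('a, 'b) gorder_scheme \<Rightarrow> 'a set \<Rightarrow> bool"
  where "countably_directed L D \<longleftrightarrow>
    D \<subseteq> carrier L \<and> D \<noteq> {} \<and> (\<forall>C. countable C \<and> C \<subseteq> D \<longrightarrow> (\<exists>d\<in>D. d \<in> Upper L C))"

definition countably_filtered :: "('a, 'b) gorder_scheme \<Rightarrow> 'a set \<Rightarrow> bool"
  where "countably_filtered L D \<longleftrightarrow>
    D \<subseteq> carrier L \<and> D \<noteq> {} \<and> (\<forall>C. countable C \<and> C \<subseteq> D \<longrightarrow> (\<exists>d\<in>D. d \<in> Lower L C))"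

definition upper_set :: "('a, 'b) gorder_scheme \<Rightarrow> 'a set \<Rightarrow> bool"
  where "upper_set L U \<longleftrightarrow>
    U \<subseteq> carrier L \<and> (\<forall>x\<in>U. \<forall>y\<in>carrier L. x \<sqsubseteq>\<^bsub>L\<^esub> y \<longrightarrow> y \<in> U)"

definition countable_filter :: "('a, 'b) gorder_scheme \<Rightarrow> 'a set \<Rightarrow> bool"
  where "countable_filter L F \<longleftrightarrow> F \<noteq> {} \<and> countably_filtered L F \<and> upper_set L F"

text \<open>\<open>least L s (Upper L D)\<close> says that \<open>s\<close> is the least upper bound of \<open>D\<close> in \<open>L\<close>.\<close>

definition sigma_Scott_open :: "('a, 'b) gorder_scheme \<Rightarrow> 'a set \<Rightarrow> bool"
  where "sigma_Scott_open L U \<longleftrightarrow>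
    upper_set L U \<and>
    (\<forall>D s. countably_directed L D \<and> least L s (Upper L D) \<and> s \<in> U \<longrightarrow> D \<inter> U \<noteq> {})"

definition OCFilt_sigma :: "('a, 'b) gorder_scheme \<Rightarrow> 'a set set"
  where "OCFilt_sigma L = {F. sigma_Scott_open L F \<and> countable_filter L F}"

definition order_isomorphism ::
    "('a, 'c) gorder_scheme \<Rightarrow> ('b, 'd) gorder_scheme \<Rightarrow> ('a \<Rightarrow> 'b) \<Rightarrow> bool"
  where "order_isomorphism L M f \<longleftrightarrow>
    bij_betw f (carrier L) (carrier M) \<and>
    (\<forall>x\<in>carrier L. \<forall>y\<in>carrier L. x \<sqsubseteq>\<^bsub>L\<^esub> y \<longleftrightarrow> f x \<sqsubseteq>\<^bsub>M\<^esub> f y)"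


section \<open>Topological notions\<close>

text \<open>
  The explicit \<^term>\<open>topspace X\<close> makes the empty intersection the whole space
  instead of \<^const>\<open>UNIV\<close>.
\<close>

definition saturatedin :: "'a topology \<Rightarrow> 'a set \<Rightarrow> bool"
  where "saturatedin X S \<longleftrightarrow> (\<exists>\<U>. (\<forall>U\<in>\<U>. openin X U) \<and> S = topspace X \<inter> \<Inter>\<U>)"

definition Lindelofin :: "'a topology \<Rightarrow> 'a set \<Rightarrow> bool"
  where "Lindelofin X S \<longleftrightarrow>
    S \<subseteq> topspace X \<and>
    (\<forall>\<U>. (\<forall>U\<in>\<U>. openin X U) \<and> S \<subseteq> \<Union>\<U> \<longrightarrow>
         (\<exists>\<V>. countable \<V> \<and> \<V> \<subseteq> \<U> \<and> S \<subseteq> \<Union>\<V>))"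

lemma Lindelofin_iff_Lindelof_space:
  "Lindelofin X S \<longleftrightarrow> S \<subseteq> topspace X \<and> Lindelof_space (subtopology X S)"
  by (simp add: Lindelofin_def Lindelof_space_subtopology_subset cong: conj_cong)

definition LQ :: "'a topology \<Rightarrow> 'a set set"
  where "LQ X = {K. saturatedin X K \<and> Lindelofin X K}"

text \<open>
  Being countably filtered and having intersection inside \<open>U\<close> only depend on the range of an
  indexed family, so families are rendered as sets of sets.
\<close>

definition c_well_filtered :: "'a topology \<Rightarrow> bool"
  where "c_well_filtered X \<longleftrightarrow>
    (\<forall>\<K> U. countably_filtered (inclusion_order (LQ X)) \<K> \<and> openin X U \<and> \<Inter>\<K> \<subseteq> U \<longrightarrow>
           (\<exists>K\<in>\<K>. K \<subseteq> U))"

definition locally_Lindelof :: "'a topology \<Rightarrow> bool"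
  where "locally_Lindelof X \<longleftrightarrow>
    (\<forall>U x. openin X U \<and> x \<in> U \<longrightarrow> (\<exists>K\<in>LQ X. x \<in> X interior_of K \<and> K \<subseteq> U))"

definition neighbourhoods :: "'a topology \<Rightarrow> 'a \<Rightarrow> 'a set set"
  where "neighbourhoods X p = {N. N \<subseteq> topspace X \<and> p \<in> X interior_of N}"

text \<open>
  The empty intersection is excluded since \<^term>\<open>\<Inter>{}\<close> is \<^const>\<open>UNIV\<close>; as a subset of the
  space it would be \<^term>\<open>topspace X\<close>, which is always a neighbourhood.
\<close>

definition P_space :: "'a topology \<Rightarrow> bool"
  where "P_space X \<longleftrightarrow>
    (\<forall>p\<in>topspace X. \<forall>\<N>. countable \<N> \<and> \<N> \<noteq> {} \<and> \<N> \<subseteq> neighbourhoods X p \<longrightarrow>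
                          \<Inter>\<N> \<in> neighbourhoods X p)"

definition phi' :: "'a topology \<Rightarrow> 'a set \<Rightarrow> 'a set set"
  where "phi' X U = {K \<in> LQ X. K \<subseteq> U}"

end

theory Submission
  imports Defs
begin

text \<open>
  A \<open>\<sigma>\<close>-Scott open countable filter \<open>F\<close> of saturated Lindelof sets under reverse inclusion
  is recovered from the open set \<open>\<Union>F\<close>. The bridge between the filter and the topology is the
  neighbourhood family \<open>{Q. K \<subseteq> int Q}\<close> of a member \<open>K\<close>. Local Lindelofness lets every open
  set around \<open>K\<close> contain such a \<open>Q\<close> (\<open>Lindelof_neighbourhood\<close>): the Lindelof property of \<open>K\<close>
  turns a choice of neighbourhoods point by point into a countable union. In a \<open>P\<close>-space countable
  intersections of open sets are open, so the family is even countably filtered, and its infimum is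
  \<open>K\<close> because \<open>K\<close> is saturated. Hence \<open>K\<close> is a supremum of a countably directed family for reverse
  inclusion, and \<open>\<sigma>\<close>-Scott openness puts some \<open>Q\<close> with \<open>K \<subseteq> int Q\<close> into \<open>F\<close>
  (\<open>sigma_Scott_open_interior\<close>). So every member of \<open>F\<close> lies in the interior of some
  member, \<open>\<Union>F\<close> is open, and a Lindelof set inside \<open>\<Union>F\<close> is covered by countably many
  members of \<open>F\<close>; being a countable filter, \<open>F\<close> then contains it.

  In the other direction, \<open>\<phi>'(U)\<close> is a countable filter because countable unions of saturated
  Lindelof sets are again of this kind. Its \<open>\<sigma>\<close>-Scott openness is where \<open>c\<close>-well-filteredness
  enters: it makes the intersection of a countably filtered family Lindelof (\<open>LQ_Inter\<close>), so this
  intersection is the supremum for reverse inclusion, and then says directly that some member of the family already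
  lies in \<open>U\<close>. That \<open>\<phi>'\<close> reflects inclusion is local Lindelofness applied at the points of \<open>U\<close>.
\<close>

section \<open>The poset of saturated Lindelof sets\<close>

lemma saturatedin_iff_separated:
  "saturatedin X S \<longleftrightarrow>
     S \<subseteq> topspace X \<and> (\<forall>x\<in>S. \<forall>y\<in>topspace X - S. \<exists>U. openin X U \<and> x \<in> U \<and> y \<notin> U)"
  (is "_ \<longleftrightarrow> ?R")
proof
  assume "saturatedin X S"
  then show ?R unfolding saturatedin_def by blast
next
  assume R: ?R
  have "topspace X \<inter> \<Inter>{U. openin X U \<and> S \<subseteq> U} \<subseteq> S"
  proof
    fix y assume y: "y \<in> topspace X \<inter> \<Inter>{U. openin X U \<and> S \<subseteq> U}"
    show "y \<in> S"
    proof (rule ccontr)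
      assume "y \<notin> S"
      \<comment> \<open>The union of all open sets that miss \<open>y\<close> is the largest candidate, and it covers \<open>S\<close>.\<close>
      then have "S \<subseteq> \<Union>{U. openin X U \<and> y \<notin> U}" using R y by blast
      moreover have "openin X (\<Union>{U. openin X U \<and> y \<notin> U})" by blast
      ultimately show False using y by blast
    qed
  qed
  moreover have "S \<subseteq> topspace X \<inter> \<Inter>{U. openin X U \<and> S \<subseteq> U}" using R by blast
  ultimately have eq: "S = topspace X \<inter> \<Inter>{U. openin X U \<and> S \<subseteq> U}" by (rule subset_antisym[rotated])
  show "saturatedin X S"
    unfolding saturatedin_def by (rule exI, rule conjI[OF _ eq]) simp
qed

lemma saturatedin_Union:
  assumes "\<And>K. K \<in> \<K> \<Longrightarrow> saturatedin X K"
  shows "saturatedin X (\<Union>\<K>)"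
  unfolding saturatedin_iff_separated
proof (intro conjI ballI)
  show "\<Union>\<K> \<subseteq> topspace X" using assms unfolding saturatedin_iff_separated by blast
next
  fix x y assume "x \<in> \<Union>\<K>" and y: "y \<in> topspace X - \<Union>\<K>"
  then obtain K where "K \<in> \<K>" "x \<in> K" by blast
  then show "\<exists>U. openin X U \<and> x \<in> U \<and> y \<notin> U"
    using assms[of K] y unfolding saturatedin_iff_separated by blast
qed

lemma saturatedin_Inter:
  assumes "\<K> \<noteq> {}" "\<And>K. K \<in> \<K> \<Longrightarrow> saturatedin X K"
  shows "saturatedin X (\<Inter>\<K>)"
  unfolding saturatedin_iff_separated
proof (intro conjI ballI)
  show "\<Inter>\<K> \<subseteq> topspace X" using assms unfolding saturatedin_iff_separated by blast
next
  fix x y assume x: "x \<in> \<Inter>\<K>" and y: "y \<in> topspace X - \<Inter>\<K>"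
  then obtain K where "K \<in> \<K>" "y \<notin> K" by blast
  then show "\<exists>U. openin X U \<and> x \<in> U \<and> y \<notin> U"
    using assms(2)[of K] x y unfolding saturatedin_iff_separated by blast
qed

lemma Lindelofin_Union:
  assumes "countable \<K>" "\<And>K. K \<in> \<K> \<Longrightarrow> Lindelofin X K"
  shows "Lindelofin X (\<Union>\<K>)"
  unfolding Lindelofin_def
proof (intro conjI allI impI)
  show "\<Union>\<K> \<subseteq> topspace X" using assms(2) unfolding Lindelofin_def by blast
next
  fix \<U> assume U: "(\<forall>U\<in>\<U>. openin X U) \<and> \<Union>\<K> \<subseteq> \<Union>\<U>"
  have "\<forall>K\<in>\<K>. \<exists>\<V>. countable \<V> \<and> \<V> \<subseteq> \<U> \<and> K \<subseteq> \<Union>\<V>"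
  proof
    fix K assume K: "K \<in> \<K>"
    then have "K \<subseteq> \<Union>\<U>" using U by blast
    then show "\<exists>\<V>. countable \<V> \<and> \<V> \<subseteq> \<U> \<and> K \<subseteq> \<Union>\<V>"
      using assms(2)[OF K] U unfolding Lindelofin_def by meson
  qed
  then obtain f where f: "\<And>K. K \<in> \<K> \<Longrightarrow> countable (f K) \<and> f K \<subseteq> \<U> \<and> K \<subseteq> \<Union>(f K)"
    by metis
  have "countable (\<Union>(f ` \<K>))" using assms(1) f by (intro countable_UN) simp_all
  moreover have "\<Union>(f ` \<K>) \<subseteq> \<U>" using f by (intro UN_least) simp
  moreover have "\<Union>\<K> \<subseteq> \<Union>(\<Union>(f ` \<K>))"
  proof
    fix x assume "x \<in> \<Union>\<K>"
    then obtain K where K: "K \<in> \<K>" "x \<in> K" by (rule UnionE)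
    with f[OF K(1)] have "x \<in> \<Union>(f K)" by (auto dest: subsetD)
    with K(1) show "x \<in> \<Union>(\<Union>(f ` \<K>))" by auto
  qed
  ultimately show "\<exists>\<V>. countable \<V> \<and> \<V> \<subseteq> \<U> \<and> \<Union>\<K> \<subseteq> \<Union>\<V>"
    by (intro exI conjI)
qed

lemma LQ_Union:
  assumes "countable \<K>" "\<K> \<subseteq> LQ X"
  shows "\<Union>\<K> \<in> LQ X"
proof -
  have "saturatedin X K" "Lindelofin X K" if "K \<in> \<K>" for K
    using subsetD[OF assms(2) that] unfolding LQ_def by simp_all
  then have "saturatedin X (\<Union>\<K>)" "Lindelofin X (\<Union>\<K>)"
    by (auto intro: saturatedin_Union Lindelofin_Union[OF assms(1)])
  then show ?thesis unfolding LQ_def by simp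
qed

lemma LQ_subset_topspace: "K \<in> LQ X \<Longrightarrow> K \<subseteq> topspace X"
  unfolding LQ_def Lindelofin_def by blast

text \<open>
  The form in which the Lindelof property is used below: a property of points that holds locally,
  witnessed by sets from \<open>\<W>\<close>, is witnessed on all of \<open>K\<close> by countably many of them.
\<close>

lemma LQ_countable_interior_cover:
  assumes K: "K \<in> LQ X" and cov: "\<And>x. x \<in> K \<Longrightarrow> \<exists>W\<in>\<W>. x \<in> X interior_of W"
  obtains \<C> where "countable \<C>" "\<C> \<subseteq> \<W>" "K \<subseteq> (\<Union>W\<in>\<C>. X interior_of W)"
proof -
  have "K \<subseteq> \<Union>((interior_of) X ` \<W>)" using cov by blast
  moreover have "\<forall>U\<in>(interior_of) X ` \<W>. openin X U" by auto
  ultimately obtain \<V> where V: "countable \<V>" "\<V> \<subseteq> (interior_of) X ` \<W>" "K \<subseteq> \<Union>\<V>"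
    using K unfolding LQ_def Lindelofin_def by blast
  then obtain \<C> where "countable \<C>" "\<C> \<subseteq> \<W>" "\<V> = (interior_of) X ` \<C>"
    using countable_subset_image by metis
  then show ?thesis using V that by blast
qed

section \<open>Order notions for reverse inclusion\<close>

lemma inclusion_order_simps [simp]:
  "carrier (inclusion_order \<A>) = \<A>" "le (inclusion_order \<A>) = (\<subseteq>)"
  unfolding inclusion_order_def by simp_all

lemma Lower_inclusion:
  assumes "\<K> \<subseteq> \<A>"
  shows "Lower (inclusion_order \<A>) \<K> = {Q \<in> \<A>. \<forall>K\<in>\<K>. Q \<subseteq> K}"
  using assms unfolding Lower_def by auto

lemma Upper_inclusion:
  assumes "\<K> \<subseteq> \<A>"
  shows "Upper (inclusion_order \<A>) \<K> = {Q \<in> \<A>. \<Union>\<K> \<subseteq> Q}"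
  using assms unfolding Upper_def by auto

lemma countably_directed_inv_gorder:
  "countably_directed (inv_gorder L) D \<longleftrightarrow> countably_filtered L D"
  unfolding countably_directed_def countably_filtered_def by simp

lemma countably_filtered_inclusion:
  "countably_filtered (inclusion_order \<A>) \<K> \<longleftrightarrow>
     \<K> \<subseteq> \<A> \<and> \<K> \<noteq> {} \<and> (\<forall>\<C>. countable \<C> \<and> \<C> \<subseteq> \<K> \<longrightarrow> (\<exists>Q\<in>\<K>. \<forall>K\<in>\<C>. Q \<subseteq> K))"
proof -
  have "(\<exists>Q\<in>\<K>. Q \<in> Lower (inclusion_order \<A>) \<C>) \<longleftrightarrow> (\<exists>Q\<in>\<K>. \<forall>K\<in>\<C>. Q \<subseteq> K)"
    if "\<K> \<subseteq> \<A>" "\<C> \<subseteq> \<K>" for \<C>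
    unfolding Lower_inclusion[OF subset_trans[OF that(2,1)]] using that(1) by auto
  then show ?thesis
    unfolding countably_filtered_def by (simp cong: conj_cong)
qed

lemma countably_filtered_reverse_inclusion:
  "countably_filtered (inv_gorder (inclusion_order \<A>)) \<K> \<longleftrightarrow>
     \<K> \<subseteq> \<A> \<and> \<K> \<noteq> {} \<and> (\<forall>\<C>. countable \<C> \<and> \<C> \<subseteq> \<K> \<longrightarrow> (\<exists>Q\<in>\<K>. \<Union>\<C> \<subseteq> Q))"
proof -
  have "(\<exists>Q\<in>\<K>. Q \<in> Upper (inclusion_order \<A>) \<C>) \<longleftrightarrow> (\<exists>Q\<in>\<K>. \<Union>\<C> \<subseteq> Q)"
    if "\<K> \<subseteq> \<A>" "\<C> \<subseteq> \<K>" for \<C>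
    unfolding Upper_inclusion[OF subset_trans[OF that(2,1)]] using that(1) by auto
  then show ?thesis
    unfolding countably_filtered_def Lower_dual by (simp cong: conj_cong)
qed

lemma upper_set_reverse_inclusion:
  "upper_set (inv_gorder (inclusion_order \<A>)) F \<longleftrightarrow>
     F \<subseteq> \<A> \<and> (\<forall>K\<in>F. \<forall>Q\<in>\<A>. Q \<subseteq> K \<longrightarrow> Q \<in> F)"
  unfolding upper_set_def by simp

lemma least_Upper_reverse_inclusion:
  assumes "\<K> \<subseteq> \<A>"
  shows "least (inv_gorder (inclusion_order \<A>)) S
           (Upper (inv_gorder (inclusion_order \<A>)) \<K>) \<longleftrightarrow>
     S \<in> \<A> \<and> S \<subseteq> \<Inter>\<K> \<and> (\<forall>Q\<in>\<A>. Q \<subseteq> \<Inter>\<K> \<longrightarrow> Q \<subseteq> S)"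
  unfolding Upper_dual least_dual Lower_inclusion[OF assms] greatest_def
  by (auto simp: le_Inf_iff)

section \<open>Open sets give filters\<close>

text \<open>
  Applied to the union of an open cover of \<open>\<Inter>\<K>\<close>, \<open>c\<close>-well-filteredness yields a single
  \<open>K \<in> \<K>\<close> that is covered; a countable subcover of the Lindelof set \<open>K\<close> serves for \<open>\<Inter>\<K>\<close>.
\<close>

lemma LQ_Inter:
  assumes wf: "c_well_filtered X" and filt: "countably_filtered (inclusion_order (LQ X)) \<K>"
  shows "\<Inter>\<K> \<in> LQ X"
proof -
  have K: "\<K> \<subseteq> LQ X" "\<K> \<noteq> {}" using filt unfolding countably_filtered_inclusion by blast+
  have "saturatedin X (\<Inter>\<K>)" using K saturatedin_Inter[of \<K> X] unfolding LQ_def by blast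
  moreover have "Lindelofin X (\<Inter>\<K>)"
    unfolding Lindelofin_def
  proof (intro conjI allI impI)
    show "\<Inter>\<K> \<subseteq> topspace X" using K LQ_subset_topspace by blast
  next
    fix \<U> assume U: "(\<forall>U\<in>\<U>. openin X U) \<and> \<Inter>\<K> \<subseteq> \<Union>\<U>"
    then have "openin X (\<Union>\<U>)" by blast
    then obtain K' where K': "K' \<in> \<K>" "K' \<subseteq> \<Union>\<U>"
      using wf filt U unfolding c_well_filtered_def by blast
    then have "Lindelofin X K'" using K unfolding LQ_def by blast
    then obtain \<V> where "countable \<V>" "\<V> \<subseteq> \<U>" "K' \<subseteq> \<Union>\<V>"
      using K' U unfolding Lindelofin_def by meson
    then show "\<exists>\<V>. countable \<V> \<and> \<V> \<subseteq> \<U> \<and> \<Inter>\<K> \<subseteq> \<Union>\<V>" using K' by blast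
  qed
  ultimately show ?thesis unfolding LQ_def by blast
qed

lemma phi'_countable_filter:
  "countable_filter (inv_gorder (inclusion_order (LQ X))) (phi' X U)"
proof -
  have union: "\<Union>\<C> \<in> phi' X U" if "countable \<C>" "\<C> \<subseteq> phi' X U" for \<C>
    using that LQ_Union[of \<C> X] unfolding phi'_def by blast
  have "phi' X U \<noteq> {}" using union[of "{}"] by auto
  moreover have "countably_filtered (inv_gorder (inclusion_order (LQ X))) (phi' X U)"
    unfolding countably_filtered_reverse_inclusion
  proof (intro conjI allI impI)
    show "phi' X U \<subseteq> LQ X" unfolding phi'_def by blast
    show "phi' X U \<noteq> {}" by fact
    show "\<exists>Q\<in>phi' X U. \<Union>\<C> \<subseteq> Q" if "countable \<C> \<and> \<C> \<subseteq> phi' X U" for \<C>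
      using union that by (intro bexI[of _ "\<Union>\<C>"]) auto
  qed
  moreover have "upper_set (inv_gorder (inclusion_order (LQ X))) (phi' X U)"
    unfolding upper_set_reverse_inclusion phi'_def by blast
  ultimately show ?thesis unfolding countable_filter_def by simp
qed

lemma phi'_sigma_Scott_open:
  assumes wf: "c_well_filtered X" and U: "openin X U"
  shows "sigma_Scott_open (inv_gorder (inclusion_order (LQ X))) (phi' X U)"
  unfolding sigma_Scott_open_def
proof (intro conjI allI impI)
  let ?L = "inv_gorder (inclusion_order (LQ X))"
  show "upper_set ?L (phi' X U)" using phi'_countable_filter unfolding countable_filter_def by blast
  fix \<K> S
  assume "countably_directed ?L \<K> \<and> least ?L S (Upper ?L \<K>) \<and> S \<in> phi' X U"
  then have dir: "countably_directed ?L \<K>" and lub: "least ?L S (Upper ?L \<K>)" and S: "S \<subseteq> U"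
    unfolding phi'_def by blast+
  have filt: "countably_filtered (inclusion_order (LQ X)) \<K>"
    using dir unfolding countably_directed_inv_gorder .
  then have K: "\<K> \<subseteq> LQ X" unfolding countably_filtered_inclusion by blast
  have "\<Inter>\<K> \<subseteq> S"
    using lub LQ_Inter[OF wf filt] unfolding least_Upper_reverse_inclusion[OF K] by blast
  then have "\<Inter>\<K> \<subseteq> U" using S by (rule subset_trans)
  then have "\<exists>K\<in>\<K>. K \<subseteq> U" using wf filt U unfolding c_well_filtered_def by simp
  then show "\<K> \<inter> phi' X U \<noteq> {}" using K unfolding phi'_def by blast
qed

section \<open>Filters come from open sets\<close>

lemma P_space_openin_Inter:
  assumes P: "P_space X" and count: "countable \<U>" and ne: "\<U> \<noteq> {}"
    and op: "\<And>U. U \<in> \<U> \<Longrightarrow> openin X U"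
  shows "openin X (\<Inter>\<U>)"
proof -
  have "\<Inter>\<U> \<subseteq> X interior_of \<Inter>\<U>"
  proof
    fix p assume p: "p \<in> \<Inter>\<U>"
    have "U \<in> neighbourhoods X p" if "U \<in> \<U>" for U
      using p that openin_subset[OF op[OF that]] interior_of_openin[OF op[OF that]]
      unfolding neighbourhoods_def by auto
    then have "\<U> \<subseteq> neighbourhoods X p" by blast
    moreover have "p \<in> topspace X" using p ne op openin_subset by blast
    ultimately have "\<Inter>\<U> \<in> neighbourhoods X p" using P count ne unfolding P_space_def by blast
    then show "p \<in> X interior_of \<Inter>\<U>" unfolding neighbourhoods_def by blast
  qed
  then show ?thesis using interior_of_subset[of X "\<Inter>\<U>"] by (metis openin_interior_of subset_antisym)
qed

lemma Lindelof_neighbourhood: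
  assumes loc: "locally_Lindelof X" and K: "K \<in> LQ X" and V: "openin X V" "K \<subseteq> V"
  obtains Q where "Q \<in> LQ X" "K \<subseteq> X interior_of Q" "Q \<subseteq> V"
proof -
  have cov: "\<exists>W\<in>phi' X V. x \<in> X interior_of W" if "x \<in> K" for x
    using loc V that unfolding locally_Lindelof_def phi'_def by blast
  obtain \<C> where C: "countable \<C>" "\<C> \<subseteq> phi' X V" "K \<subseteq> (\<Union>W\<in>\<C>. X interior_of W)"
    by (rule LQ_countable_interior_cover[OF K cov])
  show ?thesis
  proof
    show "K \<subseteq> X interior_of \<Union>\<C>"
      using C(3) interior_of_mono[of _ "\<Union>\<C>" X] by blast
    show "\<Union>\<C> \<in> LQ X" "\<Union>\<C> \<subseteq> V"
      using C(1,2) LQ_Union[of \<C> X] unfolding phi'_def by blast+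
  qed
qed

text \<open>
  The neighbourhood family of \<open>K\<close> has supremum \<open>K\<close> for reverse inclusion and is countably directed,
  so a \<open>\<sigma>\<close>-Scott open set that contains \<open>K\<close> meets it.
\<close>

lemma sigma_Scott_open_interior:
  assumes P: "P_space X" and loc: "locally_Lindelof X"
    and F: "sigma_Scott_open (inv_gorder (inclusion_order (LQ X))) F" and KF: "K \<in> F"
  obtains Q where "Q \<in> F" "K \<subseteq> X interior_of Q"
proof -
  let ?L = "inv_gorder (inclusion_order (LQ X))"
  let ?D = "{Q \<in> LQ X. K \<subseteq> X interior_of Q}"
  have K: "K \<in> LQ X"
    using F KF unfolding sigma_Scott_open_def upper_set_reverse_inclusion by blast
  have small: "\<exists>Q\<in>?D. Q \<subseteq> V" if "openin X V" "K \<subseteq> V" for V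
    by (rule Lindelof_neighbourhood[OF loc K that]) blast
  have D_LQ: "?D \<subseteq> LQ X" by blast
  have "countably_directed ?L ?D"
    unfolding countably_directed_inv_gorder countably_filtered_inclusion
  proof (intro conjI allI impI)
    show "?D \<subseteq> LQ X" by blast
    show "?D \<noteq> {}" using small[of "topspace X"] LQ_subset_topspace[OF K] by blast
  next
    fix \<C> assume C: "countable \<C> \<and> \<C> \<subseteq> ?D"
    \<comment> \<open>The whole space is added as a member so that \<open>\<C> = {}\<close> gives an open set as well.\<close>
    let ?V = "\<Inter>(insert (topspace X) ((interior_of) X ` \<C>))"
    have "openin X ?V" by (rule P_space_openin_Inter[OF P]) (use C in auto)
    moreover have "K \<subseteq> ?V" using C LQ_subset_topspace[OF K] by blast
    ultimately obtain Q where Q: "Q \<in> ?D" "Q \<subseteq> ?V" using small by meson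
    have "\<forall>W\<in>\<C>. Q \<subseteq> W" using Q(2) interior_of_subset[of X] by fast
    then show "\<exists>Q\<in>?D. \<forall>W\<in>\<C>. Q \<subseteq> W" using Q(1) by blast
  qed
  moreover have "least ?L K (Upper ?L ?D)"
    unfolding least_Upper_reverse_inclusion[OF D_LQ]
  proof (intro conjI ballI impI)
    show "K \<in> LQ X" by (rule K)
    show "K \<subseteq> \<Inter>?D" using interior_of_subset[of X] by fast
  next
    fix S assume S: "S \<in> LQ X" "S \<subseteq> \<Inter>?D"
    obtain \<U> where \<U>: "\<forall>U\<in>\<U>. openin X U" "K = topspace X \<inter> \<Inter>\<U>"
      using K unfolding LQ_def saturatedin_def by blast
    have "S \<subseteq> U" if "U \<in> \<U>" for U
      using small[of U] that \<U> S(2) by blast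
    then show "S \<subseteq> K" using \<U>(2) LQ_subset_topspace[OF S(1)] by blast
  qed
  ultimately have "?D \<inter> F \<noteq> {}" using F KF unfolding sigma_Scott_open_def by blast
  then show ?thesis using that by blast
qed

lemma OCFilt_sigma_eq_phi':
  assumes P: "P_space X" and loc: "locally_Lindelof X"
    and F: "F \<in> OCFilt_sigma (inv_gorder (inclusion_order (LQ X)))"
  shows "openin X (\<Union>F)" and "phi' X (\<Union>F) = F"
proof -
  let ?L = "inv_gorder (inclusion_order (LQ X))"
  have sso: "sigma_Scott_open ?L F" and "countably_filtered ?L F" and "upper_set ?L F"
    using F unfolding OCFilt_sigma_def countable_filter_def by simp_all
  then have FL: "F \<subseteq> LQ X" and down: "\<And>K Q. K \<in> F \<Longrightarrow> Q \<in> LQ X \<Longrightarrow> Q \<subseteq> K \<Longrightarrow> Q \<in> F"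
    and filt: "\<And>\<C>. countable \<C> \<Longrightarrow> \<C> \<subseteq> F \<Longrightarrow> \<exists>Q\<in>F. \<Union>\<C> \<subseteq> Q"
    unfolding countably_filtered_reverse_inclusion upper_set_reverse_inclusion by simp_all
  have int: "\<exists>Q\<in>F. x \<in> X interior_of Q" if "x \<in> \<Union>F" for x
  proof -
    from that obtain K where K: "K \<in> F" "x \<in> K" by blast
    from sigma_Scott_open_interior[OF P loc sso K(1)] show ?thesis using K(2) by blast
  qed
  have "\<Union>F \<subseteq> (\<Union>Q\<in>F. X interior_of Q)" using int by blast
  moreover have "(\<Union>Q\<in>F. X interior_of Q) \<subseteq> \<Union>F"
    using interior_of_subset[of X] by (meson UN_least Union_upper subset_trans)
  ultimately have "\<Union>F = (\<Union>Q\<in>F. X interior_of Q)" by (rule subset_antisym)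
  moreover have "openin X (\<Union>Q\<in>F. X interior_of Q)" by (rule openin_Union) auto
  ultimately show "openin X (\<Union>F)" by simp
  show "phi' X (\<Union>F) = F"
  proof
    show "F \<subseteq> phi' X (\<Union>F)" using FL unfolding phi'_def by blast
    show "phi' X (\<Union>F) \<subseteq> F"
    proof
      fix K assume "K \<in> phi' X (\<Union>F)"
      then have K: "K \<in> LQ X" "K \<subseteq> \<Union>F" unfolding phi'_def by blast+
      obtain \<C> where C: "countable \<C>" "\<C> \<subseteq> F" "K \<subseteq> (\<Union>W\<in>\<C>. X interior_of W)"
        by (rule LQ_countable_interior_cover[OF K(1) int[OF subsetD[OF K(2)]]])
      have "K \<subseteq> \<Union>\<C>" using C(3) interior_of_subset[of X] by fast
      moreover from filt[OF C(1,2)] obtain Q where Q: "Q \<in> F" "\<Union>\<C> \<subseteq> Q" by (rule bexE)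
      ultimately have "K \<subseteq> Q" by simp
      then show "K \<in> F" by (rule down[OF Q(1) K(1)])
    qed
  qed
qed

section \<open>The isomorphism\<close>

lemma phi'_subset_iff:
  assumes loc: "locally_Lindelof X" and U: "openin X U"
  shows "phi' X U \<subseteq> phi' X V \<longleftrightarrow> U \<subseteq> V"
proof
  assume sub: "phi' X U \<subseteq> phi' X V"
  show "U \<subseteq> V"
  proof
    fix x assume "x \<in> U"
    then obtain K where "K \<in> LQ X" "x \<in> X interior_of K" "K \<subseteq> U"
      using loc U unfolding locally_Lindelof_def by meson
    then have "K \<in> phi' X V" "x \<in> K"
      using sub interior_of_subset[of X K] unfolding phi'_def by auto
    then show "x \<in> V" unfolding phi'_def by blast
  qed
qed (auto simp: phi'_def)

theorem theorem4p8:
  fixes X :: "'a topology"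
  assumes "P_space X"
    and "locally_Lindelof X"
    and "c_well_filtered X"
  shows "order_isomorphism
           (inclusion_order {U. openin X U})
           (inclusion_order (OCFilt_sigma (inv_gorder (inclusion_order (LQ X)))))
           (phi' X)"
proof -
  let ?F = "OCFilt_sigma (inv_gorder (inclusion_order (LQ X)))"
  note emb = phi'_subset_iff[OF assms(2)]
  have "bij_betw (phi' X) {U. openin X U} ?F"
    unfolding bij_betw_def
  proof
    show "inj_on (phi' X) {U. openin X U}"
    proof (rule inj_onI)
      fix U V assume "U \<in> {U. openin X U}" "V \<in> {U. openin X U}" "phi' X U = phi' X V"
      then show "U = V" using emb[of U V] emb[of V U] by auto
    qed
    show "phi' X ` {U. openin X U} = ?F"
    proof
      show "phi' X ` {U. openin X U} \<subseteq> ?F"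
      proof (rule image_subsetI)
        fix U assume "U \<in> {U. openin X U}"
        then have "openin X U" by simp
        from phi'_sigma_Scott_open[OF assms(3) this] phi'_countable_filter[of X U]
        show "phi' X U \<in> ?F" unfolding OCFilt_sigma_def by (intro CollectI conjI)
      qed
      show "?F \<subseteq> phi' X ` {U. openin X U}"
      proof
        fix F assume "F \<in> ?F"
        from OCFilt_sigma_eq_phi'[OF assms(1,2) this]
        show "F \<in> phi' X ` {U. openin X U}" by blast
      qed
    qed
  qed
  then show ?thesis
    using emb unfolding order_isomorphism_def by simp
qed

end
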